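(* Let $\mu$ be the product measure on $2^\omega=\{0,1\}^{\omega}$ induced by the uniform measure $\mu(\{0\})=\mu(\{1\})=\tfrac12$ on $\{0,1\}$. Then for $\mu$-almost every $t\in 2^\omega$ the following holds: for every function $s:\omega\to\omega$ with $\varphi_s(n)\to\infty$ as $n\to\infty$, the sequence $t$ is $s$-uniformly distributed.
   Context: $\omega=\{0,1,2,\dots\}$ and $\log$ denotes the logarithm to base 2. For $t\in 2^\omega$, $k,n\in\omega$ with $n\ge 1$, let $$D_k(t,n)=2^k\cdot\max_{w\in\{0,1\}^k}\left|\frac{|\{i<n:(t(i),\dots,t(i+k-1))=w\}|}{n}-\frac1{2^k}\right|.$$ For $s:\omega\to\omega$, a sequence $t\in 2^\omega$ is called $s$-uniformly distributed if $\lim_{n\to\infty}D_{s(n)}(t,n)=0$. For $s:\omega\to\omega$ define $\varphi_s(n)=\lfloor \log n-\log\log n-s(n)\rfloor$ (for $n$ large enough that this is defined). *)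

theory Defs
  imports "HOL-Probability.Probability"
begin

text \<open>The alphabet \<open>{0,1}\<close> is \<^typ>\<open>bool\<close>; a word of length \<open>k\<close> is a list of length \<open>k\<close>.\<close>

definition cantor_measure :: "(nat \<Rightarrow> bool) measure" where
  "cantor_measure = (\<Pi>\<^sub>M i\<in>UNIV. measure_pmf (pmf_of_set (UNIV :: bool set)))"

definition occurrences :: "(nat \<Rightarrow> bool) \<Rightarrow> nat \<Rightarrow> bool list \<Rightarrow> nat" where
  "occurrences t n w = card {i. i < n \<and> map t [i..<i + length w] = w}"

text \<open>Meaningful for \<open>n \<ge> 1\<close>; the value at \<open>n = 0\<close> is an artefact of division by zero.\<close>

definition discrepancy :: "nat \<Rightarrow> (nat \<Rightarrow> bool) \<Rightarrow> nat \<Rightarrow> real" where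
  "discrepancy k t n =
     2 ^ k * Max ((\<lambda>w. \<bar>real (occurrences t n w) / real n - 1 / 2 ^ k\<bar>) ` {w. length w = k})"

definition uniformly_distributed :: "(nat \<Rightarrow> nat) \<Rightarrow> (nat \<Rightarrow> bool) \<Rightarrow> bool" where
  "uniformly_distributed s t \<longleftrightarrow> (\<lambda>n. discrepancy (s n) t n) \<longlonglongrightarrow> 0"

text \<open>Meaningful for \<open>n \<ge> 2\<close>; for smaller \<open>n\<close> the iterated logarithm takes junk values.\<close>

definition phi :: "(nat \<Rightarrow> nat) \<Rightarrow> nat \<Rightarrow> int" where
  "phi s n = \<lfloor>log 2 (real n) - log 2 (log 2 (real n)) - real (s n)\<rfloor>"

end

theory Submission
  imports Defs "HOL-Library.Sublist"
begin

text \<open>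
  Occurrences of a word \<open>w\<close> of length \<open>k\<close> overlap, so they are not independent, and cutting the
  sequence into \<open>k\<close> independent classes would lose a factor \<open>k\<close> in the exponent, too much for
  \<open>k\<close> as large as \<open>log n - log log n\<close>. Instead, the exponential moment of the number \<open>N\<close> of
  occurrences is multiplied by a correction that is linear in the partial matches of \<open>w\<close>: a match
  of a proper suffix of length \<open>l\<close> at the front gets weight proportional to \<open>2\<^sup>l\<close>. Prepending a
  random letter then multiplies the mean of \<open>x\<^sup>N\<close> times the correction by at most
  \<open>1 + d / 2\<^sup>k\<close> with \<open>d = (x - 1) / (2 - x)\<close>. Since \<open>d\<close> agrees with \<open>x - 1\<close> to first order,
  Chernoff's argument yields \<open>8 exp (- \<epsilon>\<^sup>2 n / (16 \<cdot> 2\<^sup>k))\<close> as a bound for relative deviations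
  of size \<open>\<epsilon>\<close>. A union bound over all words with \<open>2\<^sup>k \<le> n / (c log n)\<close> and the
  Borel-Cantelli lemma conclude.
\<close>

section \<open>Matches in finite lists and their exponential moment\<close>

definition occ :: "bool list \<Rightarrow> bool list \<Rightarrow> nat" where
  "occ w xs = (\<Sum>i<length xs. of_bool (prefix w (drop i xs)))"

lemma occ_Nil [simp]: "occ w [] = 0"
  by (simp add: occ_def)

lemma occ_Cons [simp]: "occ w (b # xs) = of_bool (prefix w (b # xs)) + occ w xs"
  by (simp only: occ_def length_Cons sum.lessThan_Suc_shift drop_0 drop_Suc_Cons)

text \<open>The total fortune in a fair betting game on letters that arrive at the front. Before
  each letter a new gambler joins with capital 1 and bets on the word from its last letter
  backwards, doubling at each success. A nonempty suffix of length \<open>l\<close> found at the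
  front is a gambler who now owns \<open>2 ^ l\<close>.\<close>

fun partial_match :: "bool list \<Rightarrow> bool list \<Rightarrow> real" where
  "partial_match [] xs = 0"
| "partial_match (a # v) xs =
     2 ^ Suc (length v) * of_bool (prefix (a # v) xs) + partial_match v xs"

lemma partial_match_nonneg: "0 \<le> partial_match v xs"
  by (induction v) auto

lemma partial_match_le: "partial_match v xs \<le> 2 ^ Suc (length v) - 2"
proof (induction v)
  case (Cons a v)
  have "2 ^ Suc (length v) * of_bool (prefix (a # v) xs) \<le> (2::real) ^ Suc (length v)"
    by simp
  with Cons have "partial_match (a # v) xs \<le> 2 ^ Suc (length v) + (2 ^ Suc (length v) - 2)"
    by (simp only: partial_match.simps add_mono)
  then show ?case by simp
qed simp

text \<open>Fairness of the game: exactly one of the two letters extends a given partial match, and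
  its weight doubles. The summand 1 is the newcomer, that is, the empty suffix.\<close>

lemma sum_partial_match_Cons:
  "(\<Sum>b\<in>UNIV. partial_match (a # v) (b # xs)) = 2 * (1 + partial_match v xs)"
proof (induction v arbitrary: a)
  case Nil
  show ?case by (cases a) (simp_all add: UNIV_bool)
next
  case (Cons c v)
  show ?case using Cons[of c] by (cases a) (simp_all add: UNIV_bool)
qed

text \<open>The correction involves only \<open>tl w\<close>, because a full match at the front is
  already counted by \<open>occ\<close>. Dividing by \<open>2 ^ length w\<close> brings the fortune
  into the interval from 0 to 1.\<close>

definition weight :: "real \<Rightarrow> bool list \<Rightarrow> bool list \<Rightarrow> real" where
  "weight x w xs = x ^ occ w xs *
     (1 + (x - 1) / (2 - x) / 2 ^ length w * partial_match (tl w) xs)"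

lemma partial_match_tl_le:
  assumes "w \<noteq> []"
  shows "partial_match (tl w) xs / 2 ^ length w \<le> 1"
proof -
  have "partial_match (tl w) xs \<le> 2 ^ length w - 2"
    using partial_match_le[of "tl w" xs] assms by (cases w) auto
  then show ?thesis by (simp add: field_simps)
qed

text \<open>The correction factor is at least 1/2: \<open>(x - 1) / (2 - x)\<close> exceeds -1/2 for
  positive \<open>x\<close>, and it multiplies a number between 0 and 1.\<close>

lemma power_occ_le_weight:
  assumes "w \<noteq> []" "0 < x" "x < 2"
  shows "x ^ occ w xs \<le> 2 * weight x w xs"
proof -
  define g where "g = partial_match (tl w) xs / 2 ^ length w"
  have g: "0 \<le> g" "g \<le> 1"
    using partial_match_nonneg partial_match_tl_le[OF assms(1)] by (auto simp: g_def)
  define d where "d = (x - 1) / (2 - x)"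
  have "- (1/2) \<le> d" using assms by (simp add: d_def field_simps)
  then have "- (1/2) * g \<le> d * g" using g by (intro mult_right_mono) auto
  then have "1/2 \<le> 1 + d * g" using g by linarith
  then have "x ^ occ w xs * (1/2) \<le> x ^ occ w xs * (1 + d * g)"
    using assms by (intro mult_left_mono) auto
  then have "x ^ occ w xs \<le> 2 * (x ^ occ w xs * (1 + d * g))" by simp
  then show ?thesis by (simp add: weight_def g_def d_def)
qed

lemma sum_weight_Cons_le:
  assumes "w \<noteq> []" "0 < x" "x < 2"
  shows "(\<Sum>b\<in>UNIV. weight x w (b # xs)) \<le>
           2 * (1 + (x - 1) / (2 - x) / 2 ^ length w) * weight x w xs"
proof -
  obtain a v where w: "w = a # v" using assms by (cases w) auto
  define d where "d = (x - 1) / (2 - x)"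
  define p :: real where "p = 1 / 2 ^ length w"
  have p: "0 < p" by (simp add: p_def)
  \<comment> \<open>This fixed-point equation is what determines \<open>d\<close>.\<close>
  have d: "(x - 1) * (1 + d) = d" using assms by (simp add: d_def field_simps)
  have weight_eq: "weight x w ys = x ^ occ w ys * (1 + d * (p * partial_match v ys))" for ys
    by (simp add: weight_def d_def p_def w)
  \<comment> \<open>A new full match trades its factor \<open>x\<close> for a unit of normalised
    fortune, so that \<open>partial_match\<close> of all of \<open>w\<close> replaces that of
    \<open>v\<close>. The trade is an equality at \<open>g = 1\<close>. For smaller \<open>g\<close>
    the error \<open>(x - 1) * (d * (1 - g))\<close> has the right sign for \<open>x\<close> on
    either side of 1, since \<open>d\<close> and \<open>x - 1\<close> have equal signs.\<close>
  have step: "weight x w (b # xs) \<le> x ^ occ w xs * (1 + d * p * partial_match w (b # xs))" for b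
  proof -
    define g where "g = p * partial_match v (b # xs)"
    have g: "0 \<le> g" "g \<le> 1"
      using partial_match_nonneg partial_match_tl_le[OF assms(1), of "b # xs"]
      by (auto simp: g_def p_def w)
    have "(x - 1) * (d * (1 - g)) = (x - 1)\<^sup>2 * (1 - g) / (2 - x)"
      by (simp add: d_def power2_eq_square)
    also have "\<dots> \<ge> 0" using g assms by (intro divide_nonneg_nonneg mult_nonneg_nonneg) auto
    finally have "(x - 1) * (1 + d * g) \<le> d" using d by (simp add: algebra_simps)
    then have le: "x ^ of_bool (prefix w (b # xs)) * (1 + d * g)
        \<le> 1 + d * (of_bool (prefix w (b # xs)) + g)"
      by (cases "prefix w (b # xs)") (auto simp: algebra_simps)
    have "p * partial_match w (b # xs) = of_bool (prefix w (b # xs)) + g"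
      by (simp add: w g_def p_def distrib_left)
    then have eq: "1 + d * p * partial_match w (b # xs) = 1 + d * (of_bool (prefix w (b # xs)) + g)"
      by (metis mult.assoc)
    have "weight x w (b # xs) = x ^ occ w xs * (x ^ of_bool (prefix w (b # xs)) * (1 + d * g))"
      unfolding weight_eq occ_Cons power_add g_def by (simp only: mult_ac)
    also have "\<dots> \<le> x ^ occ w xs * (1 + d * p * partial_match w (b # xs))"
      unfolding eq using le assms by (intro mult_left_mono) auto
    finally show ?thesis .
  qed
  \<comment> \<open>Averaging by fairness leaves \<open>1 + d * p + d * h\<close>. The product form
    that can be iterated is larger by \<open>d\<^sup>2 * (p * h)\<close>, which is nonnegative for
    either sign of \<open>d\<close>.\<close>
  define h where "h = p * partial_match v xs"
  have "0 \<le> h" using p partial_match_nonneg[of v xs] by (simp add: h_def)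
  then have "0 \<le> d\<^sup>2 * (p * h)" using p by simp
  then have "1 + d * p + d * h \<le> (1 + d * p) * (1 + d * h)"
    by (simp add: algebra_simps power2_eq_square)
  then have le: "x ^ occ w xs * (1 + d * p + d * h) \<le> x ^ occ w xs * ((1 + d * p) * (1 + d * h))"
    using assms by (intro mult_left_mono) auto
  have "(\<Sum>b\<in>UNIV. weight x w (b # xs))
      \<le> (\<Sum>b\<in>UNIV. x ^ occ w xs * (1 + d * p * partial_match w (b # xs)))"
    by (intro sum_mono step)
  also have "\<dots> = x ^ occ w xs * (2 + d * p * (\<Sum>b\<in>UNIV. partial_match w (b # xs)))"
    by (simp add: UNIV_bool algebra_simps)
  also have "\<dots> = 2 * (x ^ occ w xs * (1 + d * p + d * h))"
    unfolding w sum_partial_match_Cons by (simp add: h_def algebra_simps)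
  also have "\<dots> \<le> 2 * (x ^ occ w xs * ((1 + d * p) * (1 + d * h)))"
    using le by simp
  also have "\<dots> = 2 * (1 + d * p) * weight x w xs"
    unfolding weight_eq h_def by (simp only: mult_ac)
  finally show ?thesis by (simp add: d_def p_def)
qed

lemma lists_length_Suc:
  "{xs :: bool list. length xs = Suc m} = (\<lambda>(b, xs). b # xs) ` (UNIV \<times> {xs. length xs = m})"
  by (auto simp: length_Suc_conv image_iff)

text \<open>This matters for \<open>x < 1\<close>, where the added term is negative: only a
  nonnegative rate can be iterated and raised to powers in inequalities.\<close>

lemma growth_rate_nonneg:
  fixes x :: real
  assumes "0 < x" "x < 2"
  shows "0 \<le> 1 + (x - 1) / (2 - x) / 2 ^ k"
proof -
  have "- (2 - x) \<le> x - 1" by simp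
  moreover have "(2 - x) * 1 \<le> (2 - x) * 2 ^ k"
    using assms by (intro mult_left_mono) auto
  ultimately have "- ((2 - x) * 2 ^ k) \<le> x - 1" by simp
  then show ?thesis using assms by (simp add: field_simps)
qed

lemma sum_power_occ_le:
  fixes x :: real
  assumes "w \<noteq> []" "0 < x" "x < 2"
  shows "(\<Sum>xs | length xs = m. x ^ occ w xs) / 2 ^ m
    \<le> 2 * (1 + (x - 1) / (2 - x) / 2 ^ length w) ^ m"
proof -
  define r where "r = 1 + (x - 1) / (2 - x) / 2 ^ length w"
  have r: "0 \<le> r" unfolding r_def using assms by (intro growth_rate_nonneg)
  have *: "(\<Sum>xs | length xs = m. weight x w xs) \<le> (2 * r) ^ m"
  proof (induction m)
    case 0
    have "partial_match v [] = 0" for v by (induction v) auto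
    then show ?case by (simp add: weight_def)
  next
    case (Suc m)
    have "(\<Sum>xs | length xs = Suc m. weight x w xs)
        = (\<Sum>(b, xs)\<in>UNIV \<times> {xs. length xs = m}. weight x w (b # xs))"
      unfolding lists_length_Suc by (subst sum.reindex) (auto simp: inj_on_def split_def)
    also have "\<dots> = (\<Sum>xs | length xs = m. \<Sum>b\<in>UNIV. weight x w (b # xs))"
      unfolding sum.cartesian_product[symmetric] by (rule sum.swap)
    also have "\<dots> \<le> (\<Sum>xs | length xs = m. 2 * r * weight x w xs)"
      unfolding r_def by (intro sum_mono sum_weight_Cons_le assms)
    also have "\<dots> = 2 * r * (\<Sum>xs | length xs = m. weight x w xs)"
      by (simp add: sum_distrib_left)
    also have "\<dots> \<le> 2 * r * (2 * r) ^ m"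
      using r Suc by (intro mult_left_mono) auto
    finally show ?case by simp
  qed
  have "(\<Sum>xs | length xs = m. x ^ occ w xs) \<le> (\<Sum>xs | length xs = m. 2 * weight x w xs)"
    by (intro sum_mono power_occ_le_weight assms)
  also have "\<dots> \<le> 2 * (2 * r) ^ m"
    using * by (simp add: sum_distrib_left[symmetric])
  finally show ?thesis unfolding r_def[symmetric] by (simp add: field_simps)
qed

section \<open>From finite lists to the product measure\<close>

lemma occurrences_eq_occ:
  assumes "w \<noteq> []"
  shows "occurrences t n w = occ w (map t [0..<n + length w - 1])"
proof -
  let ?m = "n + length w - 1"
  have len: "1 \<le> length w" using assms by (cases w) auto
  \<comment> \<open>The \<open>n\<close> starting positions need \<open>length w - 1\<close> letters
    beyond the first \<open>n\<close>; a start at \<open>n\<close> or later leaves too few letters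
    for a match.\<close>
  have *: "prefix w (drop i (map t [0..<?m])) \<longleftrightarrow> i < n \<and> map t [i..<i + length w] = w"
    if "i < ?m" for i
  proof (cases "i < n")
    case True
    then have "i + length w \<le> ?m" using len by simp
    then have "take (length w) (drop i (map t [0..<?m])) = map t [i..<i + length w]"
      by (simp add: drop_map take_map)
    then show ?thesis using True by (metis prefix_def append_eq_conv_conj)
  next
    case False
    then have "length (drop i (map t [0..<?m])) < length w" using len that by simp
    then show ?thesis using False prefix_length_le by fastforce
  qed
  have "occ w (map t [0..<?m]) = (\<Sum>i<?m. of_bool (i < n \<and> map t [i..<i + length w] = w))"
    unfolding occ_def using * by (intro sum.cong) simp_all
  also have "\<dots> = card ({..<?m} \<inter> {i. i < n \<and> map t [i..<i + length w] = w})"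
    by simp
  also have "{..<?m} \<inter> {i. i < n \<and> map t [i..<i + length w] = w}
      = {i. i < n \<and> map t [i..<i + length w] = w}"
    using len by auto
  finally show ?thesis by (simp add: occurrences_def)
qed

interpretation cantor: prob_space cantor_measure
  unfolding cantor_measure_def by (intro prob_space_PiM measure_pmf.prob_space_axioms)

lemma space_cantor_measure [simp]: "space cantor_measure = UNIV"
  by (simp add: cantor_measure_def space_PiM)

lemma cylinder:
  assumes "length xs = m"
  shows "{t. map t [0..<m] = xs} \<in> sets cantor_measure"
    and "measure cantor_measure {t. map t [0..<m] = xs} = 1 / 2 ^ m"
proof -
  interpret product_prob_space "\<lambda>_. measure_pmf (pmf_of_set (UNIV :: bool set))" "UNIV :: nat set"
    by standard
  let ?M = "\<lambda>_::nat. measure_pmf (pmf_of_set (UNIV :: bool set))"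
  have eq: "{t. map t [0..<m] = xs} = prod_emb UNIV ?M {..<m} (\<Pi>\<^sub>E i\<in>{..<m}. {xs ! i})"
  proof (rule set_eqI)
    fix t :: "nat \<Rightarrow> bool"
    have "t \<in> {t. map t [0..<m] = xs} \<longleftrightarrow> (\<forall>i<m. t i = xs ! i)"
      using assms by (simp add: list_eq_iff_nth_eq)
    also have "\<dots> \<longleftrightarrow> t \<in> prod_emb UNIV ?M {..<m} (\<Pi>\<^sub>E i\<in>{..<m}. {xs ! i})"
      by (auto simp: prod_emb_iff PiE_iff)
    finally show "t \<in> {t. map t [0..<m] = xs} \<longleftrightarrow>
        t \<in> prod_emb UNIV ?M {..<m} (\<Pi>\<^sub>E i\<in>{..<m}. {xs ! i})" .
  qed
  show "{t. map t [0..<m] = xs} \<in> sets cantor_measure"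
    unfolding eq cantor_measure_def by (intro sets_PiM_I) auto
  have "emeasure cantor_measure {t. map t [0..<m] = xs} = (\<Prod>i<m. emeasure (?M i) {xs ! i})"
    unfolding eq cantor_measure_def by (intro emeasure_PiM_emb) auto
  also have "\<dots> = (\<Prod>i<m. ennreal (1 / 2))"
    by (simp only: emeasure_pmf_single) simp
  also have "\<dots> = ennreal (1 / 2 ^ m)"
    by (simp only: prod_constant ennreal_power card_lessThan power_one_over)
  finally show "measure cantor_measure {t. map t [0..<m] = xs} = 1 / 2 ^ m"
    by (simp add: measure_def)
qed

lemma finite_dimensional_event:
  shows "{t. P (map t [0..<m])} \<in> sets cantor_measure"
    and "measure cantor_measure {t. P (map t [0..<m])} = card {xs. length xs = m \<and> P xs} / 2 ^ m"
proof -
  have fin: "finite {xs :: bool list. length xs = m \<and> P xs}"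
    by (rule finite_subset[OF _ finite_lists_length_eq[of UNIV m]]) auto
  have eq: "{t. P (map t [0..<m])} =
      (\<Union>xs\<in>{xs. length xs = m \<and> P xs}. {t. map t [0..<m] = xs})"
    by auto
  show "{t. P (map t [0..<m])} \<in> sets cantor_measure"
    unfolding eq using fin cylinder(1) by (intro sets.finite_UN) auto
  have "measure cantor_measure {t. P (map t [0..<m])}
      = (\<Sum>xs | length xs = m \<and> P xs. measure cantor_measure {t. map t [0..<m] = xs})"
    unfolding eq using fin cylinder(1)
    by (intro cantor.finite_measure_finite_Union) (auto simp: disjoint_family_on_def)
  also have "\<dots> = card {xs. length xs = m \<and> P xs} / 2 ^ m"
    by (simp add: cylinder(2))
  finally show "measure cantor_measure {t. P (map t [0..<m])}
      = card {xs. length xs = m \<and> P xs} / 2 ^ m" .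
qed

text \<open>One form serves both tails: \<open>x > 1\<close> penalises too many occurrences,
  \<open>x < 1\<close> too few.\<close>

lemma exponential_Markov:
  fixes x y :: real
  assumes "w \<noteq> []" "0 < x" "x < 2" "0 < y"
    and "\<And>xs. P xs \<Longrightarrow> y \<le> x ^ occ w xs"
  shows "measure cantor_measure {t. P (map t [0..<m])}
    \<le> 2 * exp ((x - 1) / (2 - x) / 2 ^ length w * m) / y"
proof -
  have "y * card {xs. length xs = m \<and> P xs} = (\<Sum>xs | length xs = m \<and> P xs. y)"
    by simp
  also have "\<dots> \<le> (\<Sum>xs | length xs = m \<and> P xs. x ^ occ w xs)"
    using assms by (intro sum_mono) auto
  also have "\<dots> \<le> (\<Sum>xs | length xs = m. x ^ occ w xs)"
    using assms finite_lists_length_eq[of "UNIV :: bool set" m] by (intro sum_mono2) auto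
  finally have "y * measure cantor_measure {t. P (map t [0..<m])}
      \<le> (\<Sum>xs | length xs = m. x ^ occ w xs) / 2 ^ m"
    unfolding finite_dimensional_event(2) by (simp add: divide_right_mono)
  also have "\<dots> \<le> 2 * (1 + (x - 1) / (2 - x) / 2 ^ length w) ^ m"
    by (intro sum_power_occ_le assms)
  also have "\<dots> \<le> 2 * exp ((x - 1) / (2 - x) / 2 ^ length w) ^ m"
    using growth_rate_nonneg assms by (intro mult_left_mono power_mono exp_ge_add_one_self) auto
  also have "\<dots> = 2 * exp ((x - 1) / (2 - x) / 2 ^ length w * m)"
    by (simp only: exp_of_nat2_mult)
  finally show ?thesis using assms(4) by (simp add: pos_le_divide_eq mult.commute)
qed

section \<open>Chernoff bounds for the upper and lower tail\<close>

lemma prob_occurrences_ge: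
  assumes "w \<noteq> []" "0 < \<epsilon>" "\<epsilon> \<le> 1"
  shows "measure cantor_measure {t. (1 + \<epsilon>) * (n / 2 ^ length w) \<le> occurrences t n w}
    \<le> 6 * exp (- (\<epsilon>\<^sup>2 / 16) * (n / 2 ^ length w))"
proof -
  \<comment> \<open>The moment is taken at \<open>x = 1 + u\<close>. The choice of \<open>u\<close>
    makes the gain \<open>\<epsilon> * u = 8 * u\<^sup>2\<close> dominate the second-order errors,
    \<open>3 * u\<^sup>2\<close> in total, of \<open>d\<close> and
    \<open>ln (1 + u)\<close>.\<close>
  define u where "u = \<epsilon> / 8"
  define L :: real where "L = n / 2 ^ length w"
  define m where "m = n + length w - 1"
  define d where "d = u / (1 - u)"
  have u: "0 < u" "u \<le> 1/8" and \<epsilon>: "\<epsilon> = 8 * u" using assms by (auto simp: u_def)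
  have L: "0 \<le> L" by (simp add: L_def)
  have "u \<le> (u + 2 * u\<^sup>2) * (1 - u)"
  proof -
    have "0 \<le> u\<^sup>2 * (1 - 2 * u)" using u by simp
    then show ?thesis by (simp add: algebra_simps power2_eq_square)
  qed
  then have d: "0 \<le> d" "d \<le> u + 2 * u\<^sup>2" "d \<le> 1"
    using u by (auto simp: d_def pos_divide_le_eq)
  have y: "exp ((u - u\<^sup>2) * ((1 + \<epsilon>) * L)) \<le> (1 + u) ^ N" if "(1 + \<epsilon>) * L \<le> N" for N :: nat
  proof -
    have "u - u\<^sup>2 \<le> ln (1 + u)" using u by (intro ln_one_plus_pos_lower_bound) auto
    moreover have "0 \<le> u - u\<^sup>2" using u by (simp add: power2_eq_square)
    ultimately have "(u - u\<^sup>2) * ((1 + \<epsilon>) * L) \<le> ln (1 + u) * N"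
      using that u L assms by (intro mult_mono) auto
    then have "exp ((u - u\<^sup>2) * ((1 + \<epsilon>) * L)) \<le> exp (N * ln (1 + u))"
      by (simp add: mult.commute)
    then show ?thesis using u by (simp add: exp_of_nat_mult)
  qed
  \<comment> \<open>The surplus letters from the overhang of the last windows add at most 1 to the
    exponent; bounding \<open>exp 1\<close> by 3 then turns the factor 2 into 6.\<close>
  have "real (length w) \<le> 2 ^ length w" by (simp add: less_imp_le)
  moreover have "real m \<le> n + length w" by (simp add: m_def)
  ultimately have "real m \<le> real n + 2 ^ length w" by linarith
  then have "m / 2 ^ length w \<le> (real n + 2 ^ length w) / 2 ^ length w"
    by (rule divide_right_mono) simp
  then have "m / 2 ^ length w \<le> L + 1" by (simp add: L_def add_divide_distrib)
  then have "d * (m / 2 ^ length w) \<le> d * (L + 1)" using d by (intro mult_left_mono) auto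
  also have "\<dots> \<le> (u + 2 * u\<^sup>2) * L + 1"
    using d L mult_right_mono[of d "u + 2 * u\<^sup>2" L] by (simp add: algebra_simps)
  finally have dm: "d * (m / 2 ^ length w) \<le> (u + 2 * u\<^sup>2) * L + 1" .
  have "measure cantor_measure {t. (1 + \<epsilon>) * L \<le> occurrences t n w}
      \<le> 2 * exp ((1 + u - 1) / (2 - (1 + u)) / 2 ^ length w * m) / exp ((u - u\<^sup>2) * ((1 + \<epsilon>) * L))"
    unfolding occurrences_eq_occ[OF assms(1)] m_def
    by (rule exponential_Markov[where P = "\<lambda>xs. (1 + \<epsilon>) * L \<le> occ w xs"]) (use assms u y in auto)
  also have "\<dots> = 2 * exp (d * (m / 2 ^ length w) - (u - u\<^sup>2) * ((1 + \<epsilon>) * L))"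
    by (simp add: exp_diff d_def)
  also have "\<dots> \<le> 2 * exp (1 + - (\<epsilon>\<^sup>2 / 16) * L)"
  proof -
    \<comment> \<open>The coefficient of \<open>L\<close> is
      \<open>- 5 * u\<^sup>2 + 8 * u ^ 3\<close>, hence at most \<open>- 4 * u\<^sup>2\<close>,
      which is the claimed \<open>- (\<epsilon>\<^sup>2 / 16)\<close>.\<close>
    have "8 * u ^ 3 \<le> u\<^sup>2" using u by (simp add: power2_eq_square power3_eq_cube)
    then have "u + 2 * u\<^sup>2 - (u - u\<^sup>2) * (1 + \<epsilon>) \<le> - (\<epsilon>\<^sup>2 / 16)"
      by (simp add: \<epsilon> algebra_simps power2_eq_square power3_eq_cube)
    from mult_right_mono[OF this L] dm show ?thesis by (simp add: algebra_simps)
  qed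
  also have "\<dots> \<le> 2 * (3 * exp (- (\<epsilon>\<^sup>2 / 16) * L))"
    unfolding exp_add using exp_le by (intro mult_left_mono mult_right_mono) auto
  finally show ?thesis by (simp add: L_def)
qed

lemma prob_occurrences_le:
  assumes "w \<noteq> []" "0 < \<epsilon>" "\<epsilon> \<le> 1"
  shows "measure cantor_measure {t. occurrences t n w \<le> (1 - \<epsilon>) * (n / 2 ^ length w)}
    \<le> 2 * exp (- (\<epsilon>\<^sup>2 / 16) * (n / 2 ^ length w))"
proof -
  define u where "u = \<epsilon> / 8"
  define L :: real where "L = n / 2 ^ length w"
  define m where "m = n + length w - 1"
  define d where "d = - u / (1 + u)"
  have u: "0 < u" "u \<le> 1/8" and \<epsilon>: "\<epsilon> = 8 * u" using assms by (auto simp: u_def)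
  have L: "0 \<le> L" by (simp add: L_def)
  have "- u \<le> (- u + u\<^sup>2) * (1 + u)"
    using u by (simp add: algebra_simps power2_eq_square)
  then have d: "d \<le> 0" "d \<le> - u + u\<^sup>2"
    using u unfolding d_def by (auto simp only: pos_divide_le_eq)
  have y: "exp (- (u + 2 * u\<^sup>2) * ((1 - \<epsilon>) * L)) \<le> (1 - u) ^ N" if "N \<le> (1 - \<epsilon>) * L" for N :: nat
  proof -
    have ln: "- (u + 2 * u\<^sup>2) \<le> ln (1 - u)"
      using ln_one_minus_pos_lower_bound[of u] u by simp
    have "(u + 2 * u\<^sup>2) * N \<le> (u + 2 * u\<^sup>2) * ((1 - \<epsilon>) * L)"
      using that u by (intro mult_left_mono) auto
    moreover have "- (u + 2 * u\<^sup>2) * N \<le> ln (1 - u) * N"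
      using ln by (intro mult_right_mono) auto
    ultimately have "- (u + 2 * u\<^sup>2) * ((1 - \<epsilon>) * L) \<le> N * ln (1 - u)"
      by (simp only: mult_minus_left mult.commute[of "ln (1 - u)"])
    then have "exp (- (u + 2 * u\<^sup>2) * ((1 - \<epsilon>) * L)) \<le> exp (N * ln (1 - u))"
      by (simp only: exp_le_cancel_iff)
    then show ?thesis using u by (simp add: exp_of_nat_mult)
  qed
  \<comment> \<open>With \<open>x = 1 - u\<close> the rate \<open>d\<close> is negative, so the
    surplus letters only improve the bound and the factor stays 2.\<close>
  have "L \<le> m / 2 ^ length w"
    using assms by (cases w) (auto simp: m_def L_def divide_right_mono)
  then have "d * (m / 2 ^ length w) \<le> d * L" using d by (intro mult_left_mono_neg)
  also have "\<dots> \<le> (- u + u\<^sup>2) * L" using d L by (intro mult_right_mono)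
  finally have dm: "d * (m / 2 ^ length w) \<le> (- u + u\<^sup>2) * L" .
  have "measure cantor_measure {t. occurrences t n w \<le> (1 - \<epsilon>) * L}
      \<le> 2 * exp ((1 - u - 1) / (2 - (1 - u)) / 2 ^ length w * m)
          / exp (- (u + 2 * u\<^sup>2) * ((1 - \<epsilon>) * L))"
    unfolding occurrences_eq_occ[OF assms(1)] m_def
    by (rule exponential_Markov[where P = "\<lambda>xs. occ w xs \<le> (1 - \<epsilon>) * L"]) (use assms u y in auto)
  also have "\<dots> = 2 * exp (d * (m / 2 ^ length w) - - (u + 2 * u\<^sup>2) * ((1 - \<epsilon>) * L))"
    unfolding exp_diff by (simp add: d_def)
  also have "\<dots> \<le> 2 * exp (- (\<epsilon>\<^sup>2 / 16) * L)"
  proof -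
    have "0 \<le> u\<^sup>2 + 16 * u ^ 3" using u by simp
    then have "- u + u\<^sup>2 + (u + 2 * u\<^sup>2) * (1 - \<epsilon>) \<le> - (\<epsilon>\<^sup>2 / 16)"
      by (simp add: \<epsilon> algebra_simps power2_eq_square power3_eq_cube)
    from mult_right_mono[OF this L] dm show ?thesis by (simp add: algebra_simps)
  qed
  finally show ?thesis by (simp add: L_def)
qed

section \<open>Relative deviations, union bound and Borel-Cantelli\<close>

definition deviation_event :: "real \<Rightarrow> nat \<Rightarrow> bool list \<Rightarrow> (nat \<Rightarrow> bool) set" where
  "deviation_event \<epsilon> n w =
     {t. \<epsilon> * (n / 2 ^ length w) \<le> \<bar>occurrences t n w - n / 2 ^ length w\<bar>}"

lemma occurrences_Nil [simp]: "occurrences t n [] = n"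
  by (simp add: occurrences_def)

text \<open>The length \<open>s n\<close> may be 0, so the empty word must be covered; its count is
  exactly \<open>n\<close>.\<close>

lemma deviation_event_Nil: "0 < n \<Longrightarrow> 0 < \<epsilon> \<Longrightarrow> deviation_event \<epsilon> n [] = {}"
  by (auto simp: deviation_event_def mult_le_0_iff)

lemma occurrences_event: "{t. P (occurrences t n w)} \<in> sets cantor_measure"
proof (cases "w = []")
  case True
  then show ?thesis using sets.top[of cantor_measure] by (cases "P n") auto
next
  case False
  show ?thesis unfolding occurrences_eq_occ[OF False] by (rule finite_dimensional_event(1))
qed

lemma prob_deviation_event:
  assumes "0 < n" "0 < \<epsilon>" "\<epsilon> \<le> 1"
  shows "measure cantor_measure (deviation_event \<epsilon> n w)
    \<le> 8 * exp (- (\<epsilon>\<^sup>2 / 16) * (n / 2 ^ length w))"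
proof (cases "w = []")
  case True
  then show ?thesis using assms by (simp add: deviation_event_Nil)
next
  case False
  have abs: "\<epsilon> * L \<le> \<bar>N - L\<bar> \<longleftrightarrow> (1 + \<epsilon>) * L \<le> N \<or> N \<le> (1 - \<epsilon>) * L" if "0 \<le> L" for N L :: real
    using mult_nonneg_nonneg[of \<epsilon> L] that assms by (auto simp: distrib_right left_diff_distrib)
  have "deviation_event \<epsilon> n w = {t. (1 + \<epsilon>) * (n / 2 ^ length w) \<le> occurrences t n w} \<union>
      {t. occurrences t n w \<le> (1 - \<epsilon>) * (n / 2 ^ length w)}"
    unfolding deviation_event_def by (subst abs) auto
  then have "measure cantor_measure (deviation_event \<epsilon> n w)
      \<le> measure cantor_measure {t. (1 + \<epsilon>) * (n / 2 ^ length w) \<le> occurrences t n w}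
        + measure cantor_measure {t. occurrences t n w \<le> (1 - \<epsilon>) * (n / 2 ^ length w)}"
    using measure_Un_le[OF occurrences_event occurrences_event] by simp
  then show ?thesis
    using prob_occurrences_ge[OF False assms(2,3), of n] prob_occurrences_le[OF False assms(2,3), of n]
    by linarith
qed

text \<open>The words whose expected count is at least \<open>c * log 2 n\<close>. The set does not
  mention \<open>s\<close>, so a single null set will serve all \<open>s\<close> at once.\<close>

definition short_words :: "real \<Rightarrow> nat \<Rightarrow> bool list set" where
  "short_words c n = {w. 2 ^ length w * (c * log 2 n) \<le> n}"

lemma short_words_bounds:
  assumes "2 \<le> n" "1 \<le> c"
  shows "finite (short_words c n)" "card (short_words c n) \<le> n * n"
proof -
  let ?K = "{k. k < n \<and> 2 ^ k \<le> n}"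
  \<comment> \<open>Fewer than \<open>n + 1\<close> lengths occur, since
    \<open>k < 2 ^ k \<le> n\<close>, and each contributes at most \<open>n\<close> words.\<close>
  have sub: "short_words c n \<subseteq> (\<Union>k\<in>?K. {w. length w = k})"
  proof
    fix w assume w: "w \<in> short_words c n"
    have "1 \<le> log 2 n" using assms by simp
    then have "1 * 1 \<le> c * log 2 n" using assms by (intro mult_mono) auto
    then have "2 ^ length w * 1 \<le> 2 ^ length w * (c * log 2 n)" by (intro mult_left_mono) auto
    also have "\<dots> \<le> n" using w by (simp add: short_words_def)
    finally have "real (2 ^ length w) \<le> real n" by simp
    then have "2 ^ length w \<le> n" by (simp only: of_nat_le_iff)
    moreover have "length w < 2 ^ length w" by simp
    ultimately have "length w \<in> ?K" using less_le_trans by blast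
    then show "w \<in> (\<Union>k\<in>?K. {w. length w = k})" by blast
  qed
  have fin: "finite {w :: bool list. length w = k}" for k
    using finite_lists_length_eq[of "UNIV :: bool set" k] by simp
  then have finU: "finite (\<Union>k\<in>?K. {w :: bool list. length w = k})" by auto
  then show "finite (short_words c n)" using sub by (rule rev_finite_subset)
  have "card (short_words c n) \<le> card (\<Union>k\<in>?K. {w :: bool list. length w = k})"
    using sub finU by (rule card_mono[rotated])
  also have "\<dots> \<le> (\<Sum>k\<in>?K. card {w :: bool list. length w = k})"
    by (rule card_UN_le) auto
  also have "\<dots> \<le> (\<Sum>k\<in>?K. n)"
  proof (rule sum_mono)
    fix k assume "k \<in> ?K"
    then show "card {w :: bool list. length w = k} \<le> n"
      using card_lists_length_eq[of "UNIV :: bool set" k] by simp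
  qed
  also have "\<dots> \<le> n * n"
    using card_mono[of "{..<n}" ?K] by auto
  finally show "card (short_words c n) \<le> n * n" .
qed

lemma AE_eventually_no_deviation:
  assumes "0 < \<epsilon>" "\<epsilon> \<le> 1"
  shows "AE t in cantor_measure. \<forall>\<^sub>F n in sequentially.
    \<forall>w\<in>short_words (64 / \<epsilon>\<^sup>2) n. t \<notin> deviation_event \<epsilon> n w"
proof -
  \<comment> \<open>With this constant the exponent
    \<open>\<epsilon>\<^sup>2 / 16 * (c * log 2 n)\<close> equals \<open>4 * log 2 n\<close>. Each
    word then has probability at most \<open>8 / n ^ 4\<close>, and \<open>n * n\<close> words leave
    a summable bound.\<close>
  define c where "c = 64 / \<epsilon>\<^sup>2"
  have "\<epsilon>\<^sup>2 \<le> 1" using assms by (simp add: power_le_one)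
  then have c: "1 \<le> c" using assms by (simp add: c_def)
  \<comment> \<open>At \<open>n = 1\<close> the logarithm vanishes and every word would count as
    short, making the union infinite; the bound starts at 2.\<close>
  define A where "A n = (if 2 \<le> n then \<Union>w\<in>short_words c n. deviation_event \<epsilon> n w else {})" for n
  have dev: "deviation_event \<epsilon> n w \<in> sets cantor_measure" for n w
    unfolding deviation_event_def by (rule occurrences_event)
  have A: "A n \<in> sets cantor_measure" for n
    using dev short_words_bounds(1)[OF _ c] by (auto simp: A_def)
  have bound: "measure cantor_measure (A n) \<le> 8 * (1 / real n ^ 2)" for n
  proof (cases "2 \<le> n")
    case True
    have "measure cantor_measure (A n)
        \<le> (\<Sum>w\<in>short_words c n. measure cantor_measure (deviation_event \<epsilon> n w))"
      using True dev short_words_bounds(1)[OF True c] unfolding A_def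
      by (auto intro!: measure_UNION_le)
    also have "\<dots> \<le> (\<Sum>w\<in>short_words c n. 8 / real n ^ 4)"
    proof (rule sum_mono)
      fix w assume "w \<in> short_words c n"
      then have "c * log 2 n \<le> n / 2 ^ length w"
        by (simp add: short_words_def field_simps)
      then have "\<epsilon>\<^sup>2 / 16 * (c * log 2 n) \<le> \<epsilon>\<^sup>2 / 16 * (n / 2 ^ length w)"
        by (intro mult_left_mono) auto
      moreover have "\<epsilon>\<^sup>2 / 16 * (c * log 2 n) = 4 * log 2 n"
        using assms by (simp add: c_def)
      moreover have "ln n \<le> log 2 n"
      proof -
        have "ln 2 \<le> (1::real)" using ln_2_less_1 by simp
        then have "ln n * ln 2 \<le> ln n * 1" using True by (intro mult_left_mono) auto
        then show ?thesis by (simp add: log_def field_simps)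
      qed
      ultimately have "- (\<epsilon>\<^sup>2 / 16) * (n / 2 ^ length w) \<le> - (4 * ln n)" by linarith
      then have "exp (- (\<epsilon>\<^sup>2 / 16) * (n / 2 ^ length w)) \<le> exp (- (4 * ln n))"
        by (simp only: exp_le_cancel_iff)
      also have "\<dots> = 1 / real n ^ 4"
        using True exp_of_nat_mult[of 4 "ln n"] by (simp add: exp_minus field_simps)
      finally show "measure cantor_measure (deviation_event \<epsilon> n w) \<le> 8 / real n ^ 4"
        using prob_deviation_event[of n \<epsilon> w] True assms by simp
    qed
    also have "\<dots> \<le> real (n * n) * (8 / real n ^ 4)"
      unfolding sum_constant using short_words_bounds(2)[OF True c]
      by (intro mult_right_mono) (simp_all only: of_nat_le_iff, simp)
    also have "\<dots> = 8 * (1 / real n ^ 2)"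
      using True by (simp add: power2_eq_square power4_eq_xxxx)
    finally show ?thesis .
  qed (simp add: A_def)
  have "summable (\<lambda>n. 8 * (1 / real n ^ 2))"
    using inverse_power_summable[of 2, where 'a = real]
    by (intro summable_mult) (simp add: inverse_eq_divide)
  then have "summable (\<lambda>n. measure cantor_measure (A n))"
    by (rule summable_comparison_test'[where N = 0]) (use bound in simp)
  then have "AE t in cantor_measure. \<forall>\<^sub>F n in sequentially. t \<in> space cantor_measure - A n"
    using A by (intro borel_cantelli_AE1) (auto simp: cantor.emeasure_eq_measure)
  then show ?thesis
  proof eventually_elim
    case (elim t)
    then show ?case using eventually_ge_at_top[of 2]
      by eventually_elim (auto simp: A_def c_def)
  qed
qed

section \<open>Admissible lengths and the discrepancy\<close>

lemma eventually_short_words: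
  assumes "filterlim (phi s) at_top sequentially"
  shows "\<forall>\<^sub>F n in sequentially. \<forall>w. length w = s n \<longrightarrow> w \<in> short_words c n"
proof -
  \<comment> \<open>Divergence of \<open>phi s\<close> absorbs any constant factor: once
    \<open>phi s n\<close> reaches \<open>M\<close>, exponentiating to base 2 gives
    \<open>2 ^ s n * (2 ^ M * log 2 n) \<le> n\<close>.\<close>
  obtain M :: nat where M: "c \<le> 2 ^ M"
    using real_arch_pow[of 2 c] by (auto intro: less_imp_le)
  have "\<forall>\<^sub>F n in sequentially. int M \<le> phi s n"
    using assms by (simp add: filterlim_at_top)
  then show ?thesis using eventually_ge_at_top[of 2]
  proof eventually_elim
    case (elim n)
    have log: "0 < log 2 n" using elim by simp
    have "real M \<le> log 2 n - log 2 (log 2 n) - s n"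
      using elim(1) unfolding phi_def by (simp add: le_floor_iff)
    then have "2 powr (s n + M + log 2 (log 2 n)) \<le> 2 powr (log 2 n)"
      by (intro powr_mono) auto
    then have "2 ^ s n * (2 ^ M * log 2 n) \<le> n"
      using elim log by (simp add: powr_add powr_realpow)
    moreover have "2 ^ s n * (c * log 2 n) \<le> 2 ^ s n * (2 ^ M * log 2 n)"
      using M log by (intro mult_left_mono mult_right_mono) auto
    ultimately have "2 ^ s n * (c * log 2 n) \<le> n" by linarith
    then show ?case by (simp add: short_words_def)
  qed
qed

lemma discrepancy_nonneg: "0 \<le> discrepancy k t n"
proof -
  have fin: "finite {w :: bool list. length w = k}"
    using finite_lists_length_eq[of "UNIV :: bool set" k] by simp
  let ?f = "\<lambda>w. \<bar>real (occurrences t n w) / real n - 1 / 2 ^ k\<bar>"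
  have "?f (replicate k True) \<le> Max (?f ` {w. length w = k})"
    using fin by (intro Max_ge) auto
  then have "0 \<le> Max (?f ` {w. length w = k})" by linarith
  then show ?thesis by (simp add: discrepancy_def)
qed

lemma discrepancy_le:
  assumes "0 < n" "\<And>w. length w = k \<Longrightarrow> t \<notin> deviation_event \<epsilon> n w"
  shows "discrepancy k t n \<le> \<epsilon>"
proof -
  have fin: "finite {w :: bool list. length w = k}"
    using finite_lists_length_eq[of "UNIV :: bool set" k] by simp
  have ne: "{w :: bool list. length w = k} \<noteq> {}"
    using length_replicate[of k True] by blast
  have "\<bar>real (occurrences t n w) / real n - 1 / 2 ^ k\<bar> \<le> \<epsilon> / 2 ^ k" if "length w = k" for w
  proof -
    have "\<bar>occurrences t n w - n / 2 ^ k\<bar> \<le> \<epsilon> * (n / 2 ^ k)"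
      using assms(2)[OF that] that by (simp add: deviation_event_def)
    then have "\<bar>occurrences t n w - n / 2 ^ k\<bar> / n \<le> \<epsilon> * (n / 2 ^ k) / n"
      by (rule divide_right_mono) simp
    moreover have "\<bar>occurrences t n w - n / 2 ^ k\<bar> / n
        = \<bar>(occurrences t n w - n / 2 ^ k) / n\<bar>" by simp
    ultimately show ?thesis using assms(1) by (simp add: diff_divide_distrib)
  qed
  then have "Max ((\<lambda>w. \<bar>real (occurrences t n w) / real n - 1 / 2 ^ k\<bar>) ` {w. length w = k}) \<le> \<epsilon> / 2 ^ k"
    using fin ne by (intro Max.boundedI) auto
  then show ?thesis by (simp add: discrepancy_def field_simps)
qed

theorem theorem2:
  shows "AE t in cantor_measure. \<forall>s :: nat \<Rightarrow> nat.
           filterlim (phi s) at_top sequentially \<longrightarrow> uniformly_distributed s t"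
proof -
  \<comment> \<open>Countably many tolerances keep the union of the exceptional sets null;
    \<open>s\<close>, with its uncountably many values, is fixed only afterwards.\<close>
  define e :: "nat \<Rightarrow> real" where "e j = 1 / Suc j" for j
  have "AE t in cantor_measure. \<forall>j. \<forall>\<^sub>F n in sequentially.
      \<forall>w\<in>short_words (64 / (e j)\<^sup>2) n. t \<notin> deviation_event (e j) n w"
    unfolding AE_all_countable by (intro allI AE_eventually_no_deviation) (auto simp: e_def)
  then show ?thesis
  proof (eventually_elim, intro allI impI)
    fix t s
    assume t: "\<forall>j. \<forall>\<^sub>F n in sequentially.
        \<forall>w\<in>short_words (64 / (e j)\<^sup>2) n. t \<notin> deviation_event (e j) n w"
      and s: "filterlim (phi s) at_top sequentially"
    show "uniformly_distributed s t"
      unfolding uniformly_distributed_def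
    proof (rule order_tendstoI)
      fix a :: real assume "a < 0"
      then show "\<forall>\<^sub>F n in sequentially. a < discrepancy (s n) t n"
        by (intro always_eventually allI) (rule less_le_trans[OF _ discrepancy_nonneg])
    next
      fix a :: real assume "0 < a"
      then obtain j where j: "e j < a"
        using reals_Archimedean by (auto simp: e_def inverse_eq_divide)
      show "\<forall>\<^sub>F n in sequentially. discrepancy (s n) t n < a"
        using t[rule_format, of j] eventually_short_words[OF s, of "64 / (e j)\<^sup>2"]
          eventually_gt_at_top[of 0]
      proof eventually_elim
        case (elim n)
        then have "discrepancy (s n) t n \<le> e j" by (intro discrepancy_le) auto
        with j show ?case by simp
      qed
    qed
  qed
qed

end
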